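(* Let $\alpha$ be a binary function symbol, let $L_w$ be a language containing $\alpha$, and let $L\subseteq L_w\setminus\{\alpha\}$ be another language. Let $T$ be a universal $L_w$-theory whose terms are closed under definition by cases by open formulas, let $T'$ be a $\forall\exists$-conservative extension of $T$, and let $S\subseteq T'$ be an $L$-theory. Let $\psi(x,y,z)$ be an open $L$-formula. If $S\vdash\forall x\,\exists y\,\forall z\,\psi(x,y,z)$, then there is an $L_w$-term $t$ such that $T\vdash\forall x\,\psi(x,t(x),\alpha(x,t(x)))$.
   Context: An $L_w$-theory $T$ has terms closed under definition by cases by open formulas if for every open $L_w$-formula $\varphi(\bar x)$ and $L_w$-terms $t_1,t_2$ there is an $L_w$-term $t$ with $T\vdash\forall\bar x((\varphi(\bar x)\wedge t(\bar x)=t_1(\bar x))\vee(\neg\varphi(\bar x)\wedge t(\bar x)=t_2(\bar x)))$. For theories $T_1$ (in language $L_1$) and $T_2$ (in $L_2$) and a class $\Gamma$ of $L_1$-formulas, $T_2$ is $\Gamma$-conservative over $T_1$ if for every $\varphi\in\Gamma$ that is also an $L_2$-formula, $T_1\vdash\varphi$ iff $T_2\vdash\varphi$. $T'$ is a $\forall\exists$-conservative extension of $T$ if $T'\supseteq T$ and $T'$ is conservative over $T$ for sentences of the form $\forall\bar x\exists\bar y\,\theta$ with $\theta$ open. *)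

theory Defs imports Main begin

text \<open>
  First-order logic with equality, classical, with de Bruijn indices: the variable \<open>Var i\<close> under
  \<open>k\<close> quantifiers refers to the \<open>i\<close>-th enclosing quantifier (counted from the inside) if \<open>i < k\<close>,
  and is the free variable \<open>i - k\<close> otherwise.

  A symbol is a name together with its arity; the same name used with two
  different arities denotes two different symbols. A language is a set of function symbols
  (constants being those of arity 0) and a set of relation symbols. Equality is logical.
\<close>

record ('f, 'r) lang =
  funs :: "('f \<times> nat) set"
  rels :: "('r \<times> nat) set"

definition sublang :: "('f, 'r) lang \<Rightarrow> ('f, 'r) lang \<Rightarrow> bool" where
  "sublang L L' \<longleftrightarrow> funs L \<subseteq> funs L' \<and> rels L \<subseteq> rels L'"

definition remove_fun :: "('f, 'r) lang \<Rightarrow> 'f \<times> nat \<Rightarrow> ('f, 'r) lang" where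
  "remove_fun L s = \<lparr>funs = funs L - {s}, rels = rels L\<rparr>"

datatype 'f tm = Var nat | Fun 'f "'f tm list"

datatype ('f, 'r) fm =
    Fls
  | Eq "'f tm" "'f tm"
  | Rel 'r "'f tm list"
  | Imp "('f, 'r) fm" "('f, 'r) fm"
  | All "('f, 'r) fm"

abbreviation Neg :: "('f, 'r) fm \<Rightarrow> ('f, 'r) fm" where
  "Neg \<phi> \<equiv> Imp \<phi> Fls"

abbreviation Or :: "('f, 'r) fm \<Rightarrow> ('f, 'r) fm \<Rightarrow> ('f, 'r) fm" where
  "Or \<phi> \<psi> \<equiv> Imp (Neg \<phi>) \<psi>"

abbreviation And :: "('f, 'r) fm \<Rightarrow> ('f, 'r) fm \<Rightarrow> ('f, 'r) fm" where
  "And \<phi> \<psi> \<equiv> Neg (Imp \<phi> (Neg \<psi>))"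

abbreviation Ex :: "('f, 'r) fm \<Rightarrow> ('f, 'r) fm" where
  "Ex \<phi> \<equiv> Neg (All (Neg \<phi>))"

primrec tm_of :: "('f, 'r) lang \<Rightarrow> 'f tm \<Rightarrow> bool" where
  "tm_of L (Var i) \<longleftrightarrow> True"
| "tm_of L (Fun f ts) \<longleftrightarrow> (f, length ts) \<in> funs L \<and> list_all (tm_of L) ts"

primrec fm_of :: "('f, 'r) lang \<Rightarrow> ('f, 'r) fm \<Rightarrow> bool" where
  "fm_of L Fls \<longleftrightarrow> True"
| "fm_of L (Eq s t) \<longleftrightarrow> tm_of L s \<and> tm_of L t"
| "fm_of L (Rel r ts) \<longleftrightarrow> (r, length ts) \<in> rels L \<and> list_all (tm_of L) ts"
| "fm_of L (Imp \<phi> \<psi>) \<longleftrightarrow> fm_of L \<phi> \<and> fm_of L \<psi>"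
| "fm_of L (All \<phi>) \<longleftrightarrow> fm_of L \<phi>"

primrec vars :: "'f tm \<Rightarrow> nat set" where
  "vars (Var i) = {i}"
| "vars (Fun f ts) = \<Union> (set (map vars ts))"

primrec free_vars :: "('f, 'r) fm \<Rightarrow> nat set" where
  "free_vars Fls = {}"
| "free_vars (Eq s t) = vars s \<union> vars t"
| "free_vars (Rel r ts) = \<Union> (set (map vars ts))"
| "free_vars (Imp \<phi> \<psi>) = free_vars \<phi> \<union> free_vars \<psi>"
| "free_vars (All \<phi>) = {i. Suc i \<in> free_vars \<phi>}"

primrec open_fm :: "('f, 'r) fm \<Rightarrow> bool" where
  "open_fm Fls \<longleftrightarrow> True"
| "open_fm (Eq s t) \<longleftrightarrow> True"
| "open_fm (Rel r ts) \<longleftrightarrow> True"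
| "open_fm (Imp \<phi> \<psi>) \<longleftrightarrow> open_fm \<phi> \<and> open_fm \<psi>"
| "open_fm (All \<phi>) \<longleftrightarrow> False"

primrec subst_tm :: "(nat \<Rightarrow> 'f tm) \<Rightarrow> 'f tm \<Rightarrow> 'f tm" where
  "subst_tm \<sigma> (Var i) = \<sigma> i"
| "subst_tm \<sigma> (Fun f ts) = Fun f (map (subst_tm \<sigma>) ts)"

abbreviation lift_tm :: "'f tm \<Rightarrow> 'f tm" where
  "lift_tm \<equiv> subst_tm (\<lambda>i. Var (Suc i))"

text \<open>The substitution \<open>t \<rhd> \<sigma>\<close> replaces the variable 0 by \<open>t\<close> and \<open>Suc i\<close> by \<open>\<sigma> i\<close>.\<close>

abbreviation scons :: "'f tm \<Rightarrow> (nat \<Rightarrow> 'f tm) \<Rightarrow> nat \<Rightarrow> 'f tm" (infixr "\<rhd>" 70) where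
  "t \<rhd> \<sigma> \<equiv> case_nat t \<sigma>"

primrec subst :: "(nat \<Rightarrow> 'f tm) \<Rightarrow> ('f, 'r) fm \<Rightarrow> ('f, 'r) fm" where
  "subst \<sigma> Fls = Fls"
| "subst \<sigma> (Eq s t) = Eq (subst_tm \<sigma> s) (subst_tm \<sigma> t)"
| "subst \<sigma> (Rel r ts) = Rel r (map (subst_tm \<sigma>) ts)"
| "subst \<sigma> (Imp \<phi> \<psi>) = Imp (subst \<sigma> \<phi>) (subst \<sigma> \<psi>)"
| "subst \<sigma> (All \<phi>) = All (subst (Var 0 \<rhd> (\<lambda>i. lift_tm (\<sigma> i))) \<phi>)"

abbreviation lift :: "('f, 'r) fm \<Rightarrow> ('f, 'r) fm" where
  "lift \<equiv> subst (\<lambda>i. Var (Suc i))"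

text \<open>
  \<open>L; \<Gamma> \<turnstile> \<phi>\<close>: classical natural deduction in which every formula occurring is an \<open>L\<close>-formula.
  The set \<open>\<Gamma>\<close> may be infinite. In \<open>AllI\<close>, lifting the assumptions makes the
  variable 0 an eigenvariable.
\<close>

inductive derives :: "('f, 'r) lang \<Rightarrow> ('f, 'r) fm set \<Rightarrow> ('f, 'r) fm \<Rightarrow> bool"
    ("_; _ \<turnstile> _" [51, 51, 51] 50) for L where
  Assm: "L; \<Gamma> \<turnstile> \<phi>" if "\<phi> \<in> \<Gamma>" "fm_of L \<phi>"
| ImpI: "L; \<Gamma> \<turnstile> Imp \<phi> \<psi>" if "L; insert \<phi> \<Gamma> \<turnstile> \<psi>" "fm_of L \<phi>"
| ImpE: "L; \<Gamma> \<turnstile> \<psi>" if "L; \<Gamma> \<turnstile> Imp \<phi> \<psi>" "L; \<Gamma> \<turnstile> \<phi>"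
| RAA: "L; \<Gamma> \<turnstile> \<phi>" if "L; insert (Neg \<phi>) \<Gamma> \<turnstile> Fls" "fm_of L \<phi>"
| AllI: "L; \<Gamma> \<turnstile> All \<phi>" if "L; lift ` \<Gamma> \<turnstile> \<phi>"
| AllE: "L; \<Gamma> \<turnstile> subst (t \<rhd> Var) \<phi>" if "L; \<Gamma> \<turnstile> All \<phi>" "tm_of L t"
| EqRefl: "L; \<Gamma> \<turnstile> Eq t t" if "tm_of L t"
| EqSubst: "L; \<Gamma> \<turnstile> subst (t \<rhd> Var) \<phi>" if "L; \<Gamma> \<turnstile> Eq s t" "L; \<Gamma> \<turnstile> subst (s \<rhd> Var) \<phi>"

definition sentence_of :: "('f, 'r) lang \<Rightarrow> ('f, 'r) fm \<Rightarrow> bool" where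
  "sentence_of L \<phi> \<longleftrightarrow> fm_of L \<phi> \<and> free_vars \<phi> = {}"

text \<open>A theory is a set of sentences (axioms), not required to be deductively closed.\<close>

definition theory_of :: "('f, 'r) lang \<Rightarrow> ('f, 'r) fm set \<Rightarrow> bool" where
  "theory_of L T \<longleftrightarrow> (\<forall>\<phi> \<in> T. sentence_of L \<phi>)"

definition universal_theory :: "('f, 'r) lang \<Rightarrow> ('f, 'r) fm set \<Rightarrow> bool" where
  "universal_theory L T \<longleftrightarrow>
     theory_of L T \<and> (\<forall>\<phi> \<in> T. \<exists>n \<theta>. open_fm \<theta> \<and> \<phi> = (All ^^ n) \<theta>)"

definition closed_under_cases :: "('f, 'r) lang \<Rightarrow> ('f, 'r) fm set \<Rightarrow> bool" where
  "closed_under_cases L T \<longleftrightarrow>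
     (\<forall>n \<phi> t\<^sub>1 t\<^sub>2.
        fm_of L \<phi> \<and> open_fm \<phi> \<and> free_vars \<phi> \<subseteq> {..<n} \<and>
        tm_of L t\<^sub>1 \<and> vars t\<^sub>1 \<subseteq> {..<n} \<and> tm_of L t\<^sub>2 \<and> vars t\<^sub>2 \<subseteq> {..<n} \<longrightarrow>
        (\<exists>t. tm_of L t \<and> vars t \<subseteq> {..<n} \<and>
           L; T \<turnstile> (All ^^ n) (Or (And \<phi> (Eq t t\<^sub>1)) (And (Neg \<phi>) (Eq t t\<^sub>2)))))"

definition conservative_over ::
  "('f, 'r) fm set \<Rightarrow> ('f, 'r) lang \<Rightarrow> ('f, 'r) fm set \<Rightarrow> ('f, 'r) lang \<Rightarrow> ('f, 'r) fm set \<Rightarrow> bool"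
where
  "conservative_over C L\<^sub>2 T\<^sub>2 L\<^sub>1 T\<^sub>1 \<longleftrightarrow>
     (\<forall>\<phi> \<in> C. fm_of L\<^sub>1 \<phi> \<and> fm_of L\<^sub>2 \<phi> \<longrightarrow> ((L\<^sub>1; T\<^sub>1 \<turnstile> \<phi>) \<longleftrightarrow> (L\<^sub>2; T\<^sub>2 \<turnstile> \<phi>)))"

definition AE_sentences :: "('f, 'r) lang \<Rightarrow> ('f, 'r) fm set" where
  "AE_sentences L =
     {\<phi>. sentence_of L \<phi> \<and> (\<exists>m n \<theta>. open_fm \<theta> \<and> \<phi> = (All ^^ m) ((Ex ^^ n) \<theta>))}"

text \<open>An extension may enlarge the language, but it keeps all symbols of the original one.\<close>

definition AE_conservative_extension ::
  "('f, 'r) lang \<Rightarrow> ('f, 'r) fm set \<Rightarrow> ('f, 'r) lang \<Rightarrow> ('f, 'r) fm set \<Rightarrow> bool"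
where
  "AE_conservative_extension L' T' L T \<longleftrightarrow>
     sublang L L' \<and> theory_of L' T' \<and> T \<subseteq> T' \<and> conservative_over (AE_sentences L) L' T' L T"

end

theory Submission imports Defs begin

text \<open>
  Instantiating \<open>z\<close> by \<open>\<alpha>(x,y)\<close>, the theory \<open>T'\<close> proves \<open>\<forall>x \<exists>y \<psi>(x,y,\<alpha>(x,y))\<close>, and by conservativity
  so does \<open>T\<close>. Since \<open>T\<close> is universal, Herbrand's theorem gives finitely many terms one of which is
  always a witness, and definition by cases merges them into a single term.

  For Herbrand's theorem, suppose that \<open>T\<close> together with all \<open>\<not>\<chi>(t)\<close> is consistent, and extend it to a
  complete set. Its terms modulo provable equality form a structure in which open formulas hold iff they
  are derivable, so it satisfies the universal axioms \<open>T\<close> but not \<open>\<exists>y \<chi>(y)\<close>. No Henkin witnesses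
  are needed, and only soundness of the calculus is used.
\<close>

section \<open>Substitution\<close>

lemma case_nat_Var: "case_nat (Var 0) (\<lambda>i. Var (Suc i)) = Var"
  by (rule ext) (simp split: nat.split)

lemma subst_tm_cong: "(\<And>i. i \<in> vars t \<Longrightarrow> \<sigma> i = \<tau> i) \<Longrightarrow> subst_tm \<sigma> t = subst_tm \<tau> t"
  by (induction t) auto

lemma subst_cong: "(\<And>i. i \<in> free_vars \<phi> \<Longrightarrow> \<sigma> i = \<tau> i) \<Longrightarrow> subst \<sigma> \<phi> = subst \<tau> \<phi>"
proof (induction \<phi> arbitrary: \<sigma> \<tau>)
  case (Eq s t)
  then show ?case using subst_tm_cong[of s \<sigma> \<tau>] subst_tm_cong[of t \<sigma> \<tau>] by simp
next
  case (Rel r ts)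
  then show ?case by (auto intro!: subst_tm_cong)
next
  case (Imp \<phi> \<psi>)
  from Imp.IH(1)[of \<sigma> \<tau>] Imp.IH(2)[of \<sigma> \<tau>] Imp.prems show ?case by simp
next
  case (All \<phi>)
  have "subst (Var 0 \<rhd> (\<lambda>i. lift_tm (\<sigma> i))) \<phi> = subst (Var 0 \<rhd> (\<lambda>i. lift_tm (\<tau> i))) \<phi>"
    by (rule All.IH) (auto simp: All.prems split: nat.split)
  then show ?case by simp
qed simp

lemma subst_tm_Var [simp]: "subst_tm Var t = t"
  by (induction t) (auto simp: map_idI)

lemma subst_Var [simp]: "subst Var \<phi> = \<phi>"
  by (induction \<phi>) (auto simp: map_idI case_nat_Var)

lemma subst_sentence: "free_vars \<phi> = {} \<Longrightarrow> subst \<sigma> \<phi> = \<phi>"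
  using subst_cong[of \<phi> \<sigma> Var] by simp

lemma subst_tm_subst_tm [simp]: "subst_tm \<tau> (subst_tm \<sigma> t) = subst_tm (\<lambda>i. subst_tm \<tau> (\<sigma> i)) t"
  by (induction t) auto

lemma subst_subst: "subst \<tau> (subst \<sigma> \<phi>) = subst (\<lambda>i. subst_tm \<tau> (\<sigma> i)) \<phi>"
proof (induction \<phi> arbitrary: \<sigma> \<tau>)
  case (All \<phi>)
  have "(\<lambda>i. subst_tm (Var 0 \<rhd> (\<lambda>i. lift_tm (\<tau> i))) ((Var 0 \<rhd> (\<lambda>i. lift_tm (\<sigma> i))) i)) =
        Var 0 \<rhd> (\<lambda>i. lift_tm (subst_tm \<tau> (\<sigma> i)))"
    by (rule ext) (simp split: nat.split)
  then show ?case by (simp add: All.IH)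
qed auto

lemma tm_of_subst_tm: "tm_of L t \<Longrightarrow> (\<And>i. tm_of L (\<sigma> i)) \<Longrightarrow> tm_of L (subst_tm \<sigma> t)"
  by (induction t) (auto simp: list_all_iff)

lemma fm_of_subst: "fm_of L \<phi> \<Longrightarrow> (\<And>i. tm_of L (\<sigma> i)) \<Longrightarrow> fm_of L (subst \<sigma> \<phi>)"
proof (induction \<phi> arbitrary: \<sigma>)
  case (All \<phi>)
  then show ?case by (auto intro!: All.IH tm_of_subst_tm split: nat.split)
qed (auto simp: list_all_iff tm_of_subst_tm)

lemma fm_of_inst: "fm_of L \<phi> \<Longrightarrow> tm_of L t \<Longrightarrow> fm_of L (subst (t \<rhd> Var) \<phi>)"
  by (auto intro: fm_of_subst split: nat.split)

lemma open_subst: "open_fm \<phi> \<Longrightarrow> open_fm (subst \<sigma> \<phi>)"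
  by (induction \<phi>) auto

lemma vars_subst_tm: "vars (subst_tm \<sigma> t) = (\<Union>i \<in> vars t. vars (\<sigma> i))"
  by (induction t) auto

lemma free_vars_open_subst: "open_fm \<phi> \<Longrightarrow> free_vars (subst \<sigma> \<phi>) = (\<Union>i \<in> free_vars \<phi>. vars (\<sigma> i))"
  by (induction \<phi>) (auto simp: vars_subst_tm)

text \<open>What matters later is only that the new matrix is again an instance of
  \<open>\<theta>\<close>, hence open when \<open>\<theta>\<close> is.\<close>

lemma subst_Alls: "\<exists>\<tau>. subst \<sigma> ((All ^^ n) \<theta>) = (All ^^ n) (subst \<tau> \<theta>)"
  by (induction n arbitrary: \<sigma>) auto

lemma fm_of_Alls [simp]: "fm_of L ((All ^^ n) \<theta>) = fm_of L \<theta>"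
  by (induction n) auto

lemma tm_of_mono: "tm_of L t \<Longrightarrow> sublang L L' \<Longrightarrow> tm_of L' t"
  by (induction t) (auto simp: list_all_iff sublang_def)

lemma fm_of_mono: "fm_of L \<phi> \<Longrightarrow> sublang L L' \<Longrightarrow> fm_of L' \<phi>"
  by (induction \<phi>) (auto simp: list_all_iff tm_of_mono, auto simp: sublang_def)

section \<open>Derivations\<close>

text \<open>Rules only ask for membership in the assumptions or the language, so both may grow.
  \<open>\<Delta>\<close> is arbitrary because \<open>ImpI\<close>, \<open>RAA\<close> and
  \<open>AllI\<close> change the assumptions.\<close>

lemma derives_mono:
  assumes "L; \<Gamma> \<turnstile> \<phi>" "\<Gamma> \<subseteq> \<Delta>" "sublang L L'"
  shows "L'; \<Delta> \<turnstile> \<phi>"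
  using assms
proof (induction arbitrary: \<Delta> rule: derives.induct)
  case (Assm \<phi> \<Gamma>)
  then show ?case by (auto intro: derives.Assm fm_of_mono)
next
  case (ImpI \<phi> \<Gamma> \<psi>)
  then show ?case by (intro derives.ImpI) (auto intro: fm_of_mono)
next
  case (ImpE \<Gamma> \<phi> \<psi>)
  show ?case by (rule derives.ImpE[OF ImpE.IH]) (use ImpE.prems in auto)
next
  case (RAA \<phi> \<Gamma>)
  show ?case by (rule derives.RAA[OF RAA.IH]) (use RAA.hyps RAA.prems in \<open>auto intro: fm_of_mono\<close>)
next
  case (AllI \<Gamma> \<phi>)
  then show ?case by (intro derives.AllI) (auto intro: image_mono)
next
  case (AllE \<Gamma> \<phi> t)
  show ?case by (rule derives.AllE[OF AllE.IH tm_of_mono]) (use AllE.hyps AllE.prems in auto)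
next
  case (EqRefl t \<Gamma>)
  then show ?case by (blast intro: derives.EqRefl tm_of_mono)
next
  case (EqSubst \<Gamma> s t \<phi>)
  show ?case by (rule derives.EqSubst[OF EqSubst.IH]) (use EqSubst.prems in auto)
qed

lemma sublang_refl [simp]: "sublang L L"
  by (simp add: sublang_def)

lemma derives_weaken: "L; \<Gamma> \<turnstile> \<phi> \<Longrightarrow> \<Gamma> \<subseteq> \<Delta> \<Longrightarrow> L; \<Delta> \<turnstile> \<phi>"
  by (erule derives_mono) auto

text \<open>A derivation is a finite tree and consults finitely many assumptions. This compactness
  serves the Zorn argument and Herbrand's theorem.\<close>

lemma derives_finite:
  "L; \<Gamma> \<turnstile> \<phi> \<Longrightarrow> \<exists>\<Delta>. finite \<Delta> \<and> \<Delta> \<subseteq> \<Gamma> \<and> L; \<Delta> \<turnstile> \<phi>"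
proof (induction rule: derives.induct)
  case (Assm \<phi> \<Gamma>)
  then show ?case by (intro exI[of _ "{\<phi>}"]) (auto intro: derives.Assm)
next
  case (ImpI \<phi> \<Gamma> \<psi>)
  then obtain \<Delta> where "finite \<Delta>" "\<Delta> \<subseteq> insert \<phi> \<Gamma>" "L; \<Delta> \<turnstile> \<psi>" by blast
  moreover from this have "L; \<Delta> - {\<phi>} \<turnstile> Imp \<phi> \<psi>"
    using ImpI.hyps by - (rule derives.ImpI[OF derives_weaken[of L \<Delta>]], auto)
  ultimately show ?case by (intro exI[of _ "\<Delta> - {\<phi>}"]) auto
next
  case (ImpE \<Gamma> \<phi> \<psi>)
  from ImpE.IH obtain \<Delta> \<Delta>' where "finite \<Delta>" "\<Delta> \<subseteq> \<Gamma>" "L; \<Delta> \<turnstile> Imp \<phi> \<psi>"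
    and "finite \<Delta>'" "\<Delta>' \<subseteq> \<Gamma>" "L; \<Delta>' \<turnstile> \<phi>" by (elim exE conjE)
  moreover from this have "L; \<Delta> \<union> \<Delta>' \<turnstile> \<psi>"
    by - (rule derives.ImpE[OF derives_weaken[of L \<Delta>] derives_weaken[of L \<Delta>']], auto)
  ultimately show ?case by (intro exI[of _ "\<Delta> \<union> \<Delta>'"]) auto
next
  case (RAA \<phi> \<Gamma>)
  then obtain \<Delta> where "finite \<Delta>" "\<Delta> \<subseteq> insert (Neg \<phi>) \<Gamma>" "L; \<Delta> \<turnstile> Fls" by blast
  moreover from this have "L; \<Delta> - {Neg \<phi>} \<turnstile> \<phi>"
    using RAA.hyps by - (rule derives.RAA[OF derives_weaken[of L \<Delta>]], auto)
  ultimately show ?case by (intro exI[of _ "\<Delta> - {Neg \<phi>}"]) auto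
next
  case (AllI \<Gamma> \<phi>)
  then obtain \<Delta> where "finite \<Delta>" "\<Delta> \<subseteq> lift ` \<Gamma>" "L; \<Delta> \<turnstile> \<phi>" by blast
  \<comment> \<open>\<open>AllI\<close> expects a lifted set of assumptions, so the finite set is
    pulled back along \<open>lift\<close>.\<close>
  moreover from this obtain \<Delta>' where "\<Delta>' \<subseteq> \<Gamma>" "finite \<Delta>'" "\<Delta> = lift ` \<Delta>'"
    using finite_subset_image by metis
  ultimately show ?case by (blast intro: derives.AllI)
next
  case (AllE \<Gamma> \<phi> t)
  then show ?case by (blast intro: derives.AllE)
next
  case (EqRefl t \<Gamma>)
  then show ?case by (blast intro: derives.EqRefl)
next
  case (EqSubst \<Gamma> s t \<phi>)
  from EqSubst.IH obtain \<Delta> \<Delta>' where "finite \<Delta>" "\<Delta> \<subseteq> \<Gamma>" "L; \<Delta> \<turnstile> Eq s t"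
    and "finite \<Delta>'" "\<Delta>' \<subseteq> \<Gamma>" "L; \<Delta>' \<turnstile> subst (s \<rhd> Var) \<phi>" by (elim exE conjE)
  moreover from this have "L; \<Delta> \<union> \<Delta>' \<turnstile> subst (t \<rhd> Var) \<phi>"
    by - (rule derives.EqSubst[OF derives_weaken[of L \<Delta>] derives_weaken[of L \<Delta>']], auto)
  ultimately show ?case by (intro exI[of _ "\<Delta> \<union> \<Delta>'"]) auto
qed

text \<open>\<open>AllE\<close> and \<open>EqSubst\<close> conclude with an instantiation, so they
  survive a substitution only if it commutes with filling the hole 0.\<close>

lemma subst_inst:
  "subst \<sigma> (subst (t \<rhd> Var) \<phi>) =
   subst (subst_tm \<sigma> t \<rhd> Var) (subst (Var 0 \<rhd> (\<lambda>i. lift_tm (\<sigma> i))) \<phi>)"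
  unfolding subst_subst by (rule subst_cong) (simp split: nat.split)

lemma derives_subst:
  assumes "L; \<Gamma> \<turnstile> \<phi>" "\<And>i. tm_of L (\<sigma> i)"
  shows "L; subst \<sigma> ` \<Gamma> \<turnstile> subst \<sigma> \<phi>"
  using assms
proof (induction arbitrary: \<sigma> rule: derives.induct)
  case (Assm \<phi> \<Gamma>)
  then show ?case by (auto intro: derives.Assm fm_of_subst)
next
  case (ImpI \<phi> \<Gamma> \<psi>)
  then show ?case by (auto intro!: derives.ImpI fm_of_subst)
next
  case (ImpE \<Gamma> \<phi> \<psi>)
  show ?case
    by (rule derives.ImpE[of _ _ "subst \<sigma> \<phi>"]) (use ImpE.IH[of \<sigma>] ImpE.prems in simp_all)
next
  case (RAA \<phi> \<Gamma>)
  show ?case by (rule derives.RAA) (use RAA.IH[of \<sigma>] RAA.hyps RAA.prems in \<open>auto intro: fm_of_subst\<close>)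
next
  case (AllI \<Gamma> \<phi>)
  \<comment> \<open>Under the quantifier the eigenvariable 0 stays fixed, and lifted assumptions
    become lifts of the substituted ones.\<close>
  let ?\<sigma> = "Var 0 \<rhd> (\<lambda>i. lift_tm (\<sigma> i))"
  have "L; subst ?\<sigma> ` lift ` \<Gamma> \<turnstile> subst ?\<sigma> \<phi>"
    by (rule AllI.IH) (auto intro: tm_of_subst_tm AllI.prems split: nat.split)
  also have "subst ?\<sigma> ` lift ` \<Gamma> = lift ` subst \<sigma> ` \<Gamma>"
    by (simp add: image_image subst_subst)
  finally show ?case by (simp add: derives.AllI)
next
  case (AllE \<Gamma> \<phi> t)
  have "L; subst \<sigma> ` \<Gamma> \<turnstile> All (subst (Var 0 \<rhd> (\<lambda>i. lift_tm (\<sigma> i))) \<phi>)"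
    using AllE.IH AllE.prems by simp
  then show ?case unfolding subst_inst
    by (rule derives.AllE) (simp add: tm_of_subst_tm AllE.hyps AllE.prems)
next
  case (EqRefl t \<Gamma>)
  then show ?case by (simp add: derives.EqRefl tm_of_subst_tm)
next
  case (EqSubst \<Gamma> s t \<phi>)
  show ?case unfolding subst_inst
    by (rule derives.EqSubst[of _ _ "subst_tm \<sigma> s"])
      (use EqSubst.IH[of \<sigma>] EqSubst.prems in \<open>simp_all add: subst_inst\<close>)
qed

text \<open>\<open>AllI\<close> is invertible: after lifting, variable 0 is fresh, and instantiating
  the quantifier by it recovers \<open>\<phi>\<close>.\<close>

lemma derives_All_iff: "L; \<Gamma> \<turnstile> All \<phi> \<longleftrightarrow> L; lift ` \<Gamma> \<turnstile> \<phi>"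
proof
  assume "L; \<Gamma> \<turnstile> All \<phi>"
  then have "L; lift ` \<Gamma> \<turnstile> lift (All \<phi>)"
    by (rule derives_subst) simp
  then have "L; lift ` \<Gamma> \<turnstile> subst (Var 0 \<rhd> Var) (subst (Var 0 \<rhd> (\<lambda>i. Var (Suc (Suc i)))) \<phi>)"
    by (auto intro: derives.AllE)
  moreover have "subst (Var 0 \<rhd> Var) (subst (Var 0 \<rhd> (\<lambda>i. Var (Suc (Suc i)))) \<phi>) = subst Var \<phi>"
    unfolding subst_subst by (rule subst_cong) (simp split: nat.split)
  ultimately show "L; lift ` \<Gamma> \<turnstile> \<phi>" by simp
qed (rule derives.AllI)

lemma theory_subst: "theory_of L T \<Longrightarrow> subst \<sigma> ` T = T"
  by (simp add: theory_of_def sentence_of_def subst_sentence)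

text \<open>Axioms are sentences and so fixed by lifting; \<open>x\<close> can thus be treated as
  the free variable 0 and bound again at will.\<close>

lemma theory_derives_All: "theory_of L' T \<Longrightarrow> L; T \<turnstile> All \<phi> \<longleftrightarrow> L; T \<turnstile> \<phi>"
  by (simp add: derives_All_iff theory_subst)

lemma derives_Fls: "L; \<Gamma> \<turnstile> Fls \<Longrightarrow> fm_of L \<phi> \<Longrightarrow> L; \<Gamma> \<turnstile> \<phi>"
  by (rule derives.RAA[OF derives_weaken[of L \<Gamma>]]) auto

section \<open>Provable equality as a congruence\<close>

lemma derives_Eq_sym:
  assumes "L; \<Gamma> \<turnstile> Eq s t" "tm_of L s"
  shows "L; \<Gamma> \<turnstile> Eq t s"
  \<comment> \<open>Leibniz's principle, starting from \<open>s = s\<close>; lifting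
    \<open>s\<close> protects it when the hole 0 is filled.\<close>
  using derives.EqSubst[of L \<Gamma> s t "Eq (Var 0) (lift_tm s)"] assms
  by (simp add: derives.EqRefl)

lemma derives_Eq_trans:
  assumes "L; \<Gamma> \<turnstile> Eq s t" "L; \<Gamma> \<turnstile> Eq t u"
  shows "L; \<Gamma> \<turnstile> Eq s u"
  using derives.EqSubst[of L \<Gamma> t u "Eq (lift_tm s) (Var 0)"] assms by simp

text \<open>\<open>C\<close> is a context with a hole for a list of terms.\<close>

lemma derives_cong_list:
  assumes "\<And>xs ys. \<exists>\<phi>. \<forall>s. C (xs @ s # ys) = subst (s \<rhd> Var) \<phi>"
    and "list_all2 (\<lambda>s t. L; \<Gamma> \<turnstile> Eq s t) ss ts" and "L; \<Gamma> \<turnstile> C (xs @ ss)"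
  shows "L; \<Gamma> \<turnstile> C (xs @ ts)"
  using assms(2,3)
proof (induction arbitrary: xs rule: list_all2_induct)
  case (Cons s ss t ts)
  obtain \<phi> where \<phi>: "\<And>s. C (xs @ s # ss) = subst (s \<rhd> Var) \<phi>"
    using assms(1) by blast
  \<comment> \<open>\<open>xs\<close> is the part already replaced; one use of
    \<open>EqSubst\<close> rewrites the next entry.\<close>
  have "L; \<Gamma> \<turnstile> C (xs @ t # ss)"
    using derives.EqSubst[of L \<Gamma> s t \<phi>] Cons \<phi> by metis
  then show ?case using Cons.IH[of "xs @ [t]"] by simp
qed simp

lemma derives_Rel_cong:
  assumes "list_all2 (\<lambda>s t. L; \<Gamma> \<turnstile> Eq s t) ss ts" "L; \<Gamma> \<turnstile> Rel r ss"
  shows "L; \<Gamma> \<turnstile> Rel r ts"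
proof -
  have "\<exists>\<phi>. \<forall>s. Rel r (xs @ s # ys) = subst (s \<rhd> Var) \<phi>" for xs ys
    by (rule exI[of _ "Rel r (map lift_tm xs @ Var 0 # map lift_tm ys)"]) (simp add: comp_def)
  from derives_cong_list[of "Rel r" L \<Gamma> ss ts "[]", OF this] assms show ?thesis by simp
qed

lemma derives_Fun_cong:
  assumes "list_all2 (\<lambda>s t. L; \<Gamma> \<turnstile> Eq s t) ss ts" "tm_of L (Fun f ss)"
  shows "L; \<Gamma> \<turnstile> Eq (Fun f ss) (Fun f ts)"
proof -
  \<comment> \<open>\<open>u\<close> will be the constant left side \<open>Fun f ss\<close>;
    rewriting the right side starts from reflexivity.\<close>
  have "\<exists>\<phi>. \<forall>s. Eq u (Fun f (xs @ s # ys)) = subst (s \<rhd> Var) \<phi>" for u xs ys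
    by (rule exI[of _ "Eq (lift_tm u) (Fun f (map lift_tm xs @ Var 0 # map lift_tm ys))"])
      (simp add: comp_def)
  from derives_cong_list[of "\<lambda>us. Eq (Fun f ss) (Fun f us)" L \<Gamma> ss ts "[]", OF this] assms
  show ?thesis by (simp add: derives.EqRefl)
qed

section \<open>Soundness\<close>

primrec eval :: "('f \<Rightarrow> 'd list \<Rightarrow> 'd) \<Rightarrow> (nat \<Rightarrow> 'd) \<Rightarrow> 'f tm \<Rightarrow> 'd" where
  "eval F e (Var i) = e i"
| "eval F e (Fun f ts) = F f (map (eval F e) ts)"

text \<open>The carrier is a set because the term model lives on representatives inside the type of
  terms.\<close>

primrec sat :: "'d set \<Rightarrow> ('f \<Rightarrow> 'd list \<Rightarrow> 'd) \<Rightarrow> ('r \<Rightarrow> 'd list \<Rightarrow> bool) \<Rightarrow>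
    (nat \<Rightarrow> 'd) \<Rightarrow> ('f, 'r) fm \<Rightarrow> bool" where
  "sat D F R e Fls \<longleftrightarrow> False"
| "sat D F R e (Eq s t) \<longleftrightarrow> eval F e s = eval F e t"
| "sat D F R e (Rel r ts) \<longleftrightarrow> R r (map (eval F e) ts)"
| "sat D F R e (Imp \<phi> \<psi>) \<longleftrightarrow> (sat D F R e \<phi> \<longrightarrow> sat D F R e \<psi>)"
| "sat D F R e (All \<phi>) \<longleftrightarrow> (\<forall>d \<in> D. sat D F R (case_nat d e) \<phi>)"

definition structure_for :: "('f, 'r) lang \<Rightarrow> 'd set \<Rightarrow> ('f \<Rightarrow> 'd list \<Rightarrow> 'd) \<Rightarrow> bool" where
  "structure_for L D F \<longleftrightarrow>
     (\<forall>f ds. (f, length ds) \<in> funs L \<longrightarrow> set ds \<subseteq> D \<longrightarrow> F f ds \<in> D)"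

lemma eval_subst: "eval F e (subst_tm \<sigma> t) = eval F (\<lambda>i. eval F e (\<sigma> i)) t"
  by (induction t) (auto simp: comp_def cong: map_cong)

lemma sat_subst: "sat D F R e (subst \<sigma> \<phi>) = sat D F R (\<lambda>i. eval F e (\<sigma> i)) \<phi>"
proof (induction \<phi> arbitrary: \<sigma> e)
  case (All \<phi>)
  have "(\<lambda>i. eval F (case_nat d e) ((Var 0 \<rhd> (\<lambda>i. lift_tm (\<sigma> i))) i)) =
        case_nat d (\<lambda>i. eval F e (\<sigma> i))" for d
    by (rule ext) (simp add: eval_subst split: nat.split)
  then show ?case by (simp add: All.IH)
qed (auto simp: eval_subst comp_def)

lemma sat_lift: "sat D F R (case_nat d e) (lift \<phi>) = sat D F R e \<phi>"
  by (simp add: sat_subst)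

lemma sat_inst: "sat D F R e (subst (t \<rhd> Var) \<phi>) = sat D F R (case_nat (eval F e t) e) \<phi>"
proof -
  have "(\<lambda>i. eval F e ((t \<rhd> Var) i)) = case_nat (eval F e t) e"
    by (rule ext) (simp split: nat.split)
  then show ?thesis by (simp add: sat_subst)
qed

lemma eval_in_carrier:
  "structure_for L D F \<Longrightarrow> range e \<subseteq> D \<Longrightarrow> tm_of L t \<Longrightarrow> eval F e t \<in> D"
proof (induction t)
  case (Fun f ts)
  then have "set (map (eval F e) ts) \<subseteq> D" "(f, length (map (eval F e) ts)) \<in> funs L"
    by (auto simp: list_all_iff)
  then show ?case using Fun.prems(1) unfolding structure_for_def eval.simps by blast
qed auto

text \<open>The environment varies in the induction: \<open>AllI\<close> prepends an element of
  \<open>D\<close>, and \<open>AllE\<close> works because \<open>L\<close>-terms evaluate inside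
  \<open>D\<close>.\<close>

theorem soundness:
  assumes "L; \<Gamma> \<turnstile> \<phi>" "structure_for L D F" "range e \<subseteq> D" "\<And>\<gamma>. \<gamma> \<in> \<Gamma> \<Longrightarrow> sat D F R e \<gamma>"
  shows "sat D F R e \<phi>"
  using assms
proof (induction arbitrary: e rule: derives.induct)
  case (RAA \<phi> \<Gamma>)
  show ?case
  proof (rule ccontr)
    assume "\<not> sat D F R e \<phi>"
    then have "sat D F R e Fls" by (intro RAA.IH) (use RAA.prems in auto)
    then show False by simp
  qed
next
  case (AllI \<Gamma> \<phi>)
  have "sat D F R (case_nat d e) \<phi>" if "d \<in> D" for d
    by (rule AllI.IH) (use AllI.prems that in \<open>auto simp: sat_lift image_subset_iff split: nat.splits\<close>)
  then show ?case by simp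
next
  case (AllE \<Gamma> \<phi> t)
  then show ?case by (simp add: sat_inst eval_in_carrier)
next
  case (EqSubst \<Gamma> s t \<phi>)
  then have "eval F e s = eval F e t" "sat D F R e (subst (s \<rhd> Var) \<phi>)" by simp_all
  then show ?case by (simp add: sat_inst)
qed auto

section \<open>Complete theories and their term models\<close>

text \<open>Members of \<open>M\<close> may contain free variables, which serve as generators of the term model.\<close>

locale complete_set =
  fixes L :: "('f, 'r) lang" and M :: "('f, 'r) fm set"
  assumes consistent: "\<not> L; M \<turnstile> Fls"
    and complete: "fm_of L \<phi> \<Longrightarrow> \<phi> \<in> M \<or> Neg \<phi> \<in> M"

text \<open>Zorn's lemma admits languages of any size. A refutation from the union of a chain uses
  finitely many formulas, all in one member.\<close>

lemma complete_set_extension: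
  assumes "\<not> L; \<Gamma> \<turnstile> Fls"
  obtains M where "\<Gamma> \<subseteq> M" "complete_set L M"
proof -
  let ?A = "{M. \<Gamma> \<subseteq> M \<and> \<not> L; M \<turnstile> Fls}"
  have "\<exists>M \<in> ?A. \<forall>X \<in> ?A. M \<subseteq> X \<longrightarrow> X = M"
  proof (rule subset_Zorn_nonempty)
    have "\<Gamma> \<in> ?A" using assms by simp
    then show "?A \<noteq> {}" by blast
  next
    fix C assume C: "C \<noteq> {}" "subset.chain ?A C"
    have "\<not> L; \<Union>C \<turnstile> Fls"
    proof
      assume "L; \<Union>C \<turnstile> Fls"
      then obtain \<Delta> where \<Delta>: "finite \<Delta>" "\<Delta> \<subseteq> \<Union>C" "L; \<Delta> \<turnstile> Fls"
        by (blast dest: derives_finite)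
      obtain X where X: "X \<in> C" "\<Delta> \<subseteq> X"
        using finite_subset_Union_chain[OF \<Delta>(1,2) C] .
      have "L; X \<turnstile> Fls" using \<Delta>(3) X(2) by (rule derives_weaken)
      moreover have "X \<in> ?A" using X(1) C(2) unfolding subset_chain_def by (rule rev_subsetD[OF _ conjunct1])
      ultimately show False by simp
    qed
    moreover have "\<Gamma> \<subseteq> \<Union>C"
    proof -
      from C obtain X where "X \<in> C" "X \<in> ?A" by (auto simp: subset_chain_def)
      then show ?thesis by blast
    qed
    ultimately show "\<Union>C \<in> ?A" by simp
  qed
  then obtain M where M: "\<Gamma> \<subseteq> M" "\<not> L; M \<turnstile> Fls"
    and max: "\<And>X. M \<subseteq> X \<Longrightarrow> \<not> L; X \<turnstile> Fls \<Longrightarrow> X = M" by auto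
  have "\<phi> \<in> M \<or> Neg \<phi> \<in> M" if "fm_of L \<phi>" for \<phi>
  proof (rule ccontr)
    assume "\<not> (\<phi> \<in> M \<or> Neg \<phi> \<in> M)"
    \<comment> \<open>By maximality neither \<open>\<phi>\<close> nor its negation can be added
      consistently; the two refutations together refute \<open>M\<close>.\<close>
    then have "L; insert \<phi> M \<turnstile> Fls" "L; insert (Neg \<phi>) M \<turnstile> Fls"
      using max[of "insert \<phi> M"] max[of "insert (Neg \<phi>) M"] by auto
    then have "L; M \<turnstile> Neg \<phi>" "L; M \<turnstile> \<phi>"
      using that derives.ImpI[of L \<phi> M Fls] derives.RAA[of L \<phi> M] by blast+
    then show False using M(2) derives.ImpE by blast
  qed
  with M show ?thesis by (intro that[of M]) (auto simp: complete_set_def)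
qed

text \<open>Inside a complete \<open>M\<close> connectives behave truth-functionally, so this
  replaces explicit propositional derivations.\<close>

lemma derives_if_complete:
  assumes "fm_of L \<phi>" "\<And>M. \<Gamma> \<subseteq> M \<Longrightarrow> complete_set L M \<Longrightarrow> L; M \<turnstile> \<phi>"
  shows "L; \<Gamma> \<turnstile> \<phi>"
proof (rule ccontr)
  assume "\<not> L; \<Gamma> \<turnstile> \<phi>"
  then have "\<not> L; insert (Neg \<phi>) \<Gamma> \<turnstile> Fls" using derives.RAA assms(1) by blast
  then obtain M where M: "insert (Neg \<phi>) \<Gamma> \<subseteq> M" "complete_set L M"
    by (rule complete_set_extension)
  then have "L; M \<turnstile> \<phi>" "L; M \<turnstile> Neg \<phi>"
    using assms by (auto intro: derives.Assm)
  then show False using M(2) derives.ImpE unfolding complete_set_def by blast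
qed

context complete_set
begin

lemma derives_iff_mem: "fm_of L \<phi> \<Longrightarrow> L; M \<turnstile> \<phi> \<longleftrightarrow> \<phi> \<in> M"
  using complete[of \<phi>] consistent derives.Assm[of _ M L] derives.ImpE[of L M \<phi> Fls]
  by auto

lemma derives_Imp_iff:
  assumes "fm_of L \<phi>" "fm_of L \<psi>"
  shows "L; M \<turnstile> Imp \<phi> \<psi> \<longleftrightarrow> (L; M \<turnstile> \<phi> \<longrightarrow> L; M \<turnstile> \<psi>)"
proof
  assume *: "L; M \<turnstile> \<phi> \<longrightarrow> L; M \<turnstile> \<psi>"
  show "L; M \<turnstile> Imp \<phi> \<psi>"
  proof (rule derives.ImpI)
    show "L; insert \<phi> M \<turnstile> \<psi>"
    proof (cases "\<phi> \<in> M")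
      case True
      then show ?thesis using * assms by (simp add: insert_absorb derives.Assm)
    next
      case False
      then have "L; insert \<phi> M \<turnstile> Neg \<phi>" "L; insert \<phi> M \<turnstile> \<phi>"
        using complete[of \<phi>] assms by (auto intro: derives.Assm)
      then show ?thesis using derives_Fls assms(2) derives.ImpE by blast
    qed
  qed fact
qed (blast intro: derives.ImpE)

text \<open>Representatives instead of equivalence classes keep the elements of the term model terms.\<close>

definition rep :: "'f tm \<Rightarrow> 'f tm" where
  "rep t = (SOME s. tm_of L s \<and> L; M \<turnstile> Eq t s)"

lemma rep: "tm_of L t \<Longrightarrow> tm_of L (rep t) \<and> L; M \<turnstile> Eq t (rep t)"
  unfolding rep_def by (rule someI[of _ t]) (simp add: derives.EqRefl)

lemma rep_eq_iff:
  assumes "tm_of L s" "tm_of L t"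
  shows "rep s = rep t \<longleftrightarrow> L; M \<turnstile> Eq s t"
proof
  assume "L; M \<turnstile> Eq s t"
  \<comment> \<open>Provably equal terms satisfy the same choice predicate, so \<open>SOME\<close>
    picks the same representative.\<close>
  then have "L; M \<turnstile> Eq s u \<longleftrightarrow> L; M \<turnstile> Eq t u" for u
    using assms derives_Eq_sym derives_Eq_trans by metis
  then show "rep s = rep t" by (simp add: rep_def)
qed (metis assms rep derives_Eq_sym derives_Eq_trans)

lemma list_all2_rep: "list_all (tm_of L) ts \<Longrightarrow> list_all2 (\<lambda>s t. L; M \<turnstile> Eq s t) ts (map rep ts)"
  by (induction ts) (auto simp: rep)

section \<open>The term model\<close>

abbreviation D :: "'f tm set" where
  "D \<equiv> rep ` {t. tm_of L t}"

abbreviation F :: "'f \<Rightarrow> 'f tm list \<Rightarrow> 'f tm" where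
  "F f ts \<equiv> rep (Fun f ts)"

abbreviation R :: "'r \<Rightarrow> 'f tm list \<Rightarrow> bool" where
  "R r ts \<equiv> L; M \<turnstile> Rel r ts"

text \<open>With variables denoting their own classes, truth of an open formula becomes derivability
  of that same formula.\<close>

abbreviation e :: "nat \<Rightarrow> 'f tm" where
  "e i \<equiv> rep (Var i)"

lemma structure_for_term_model: "structure_for L D F"
proof -
  have D: "tm_of L d" if d: "d \<in> D" for d
  proof -
    from d obtain t where "d = rep t" "tm_of L t" by (elim imageE CollectE)
    then show ?thesis by (simp only: rep)
  qed
  show ?thesis unfolding structure_for_def
  proof (intro allI impI)
    fix f and ds :: "'f tm list"
    assume "(f, length ds) \<in> funs L" "set ds \<subseteq> D"
    then have "tm_of L (Fun f ds)" using D by (metis list_all_iff subsetD tm_of.simps(2))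
    then show "F f ds \<in> D" by (intro imageI CollectI)
  qed
qed

lemma eval_term_model: "tm_of L t \<Longrightarrow> eval F e t = rep t"
proof (induction t)
  case (Fun f ts)
  then have "map (eval F e) ts = map rep ts"
    by (auto simp: list_all_iff)
  moreover have "rep (Fun f ts) = rep (Fun f (map rep ts))"
    using Fun.prems list_all2_rep[of ts]
    by (subst rep_eq_iff) (auto simp: list_all_iff rep intro: derives_Fun_cong)
  ultimately show ?case by (simp only: eval.simps)
qed simp

text \<open>Equality is settled by the choice of representatives, relations by congruence,
  implication by completeness.\<close>

lemma sat_open_iff: "open_fm \<phi> \<Longrightarrow> fm_of L \<phi> \<Longrightarrow> sat D F R e \<phi> \<longleftrightarrow> L; M \<turnstile> \<phi>"
proof (induction \<phi>)
  case Fls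
  then show ?case using consistent by simp
next
  case (Eq s t)
  then show ?case by (simp add: eval_term_model rep_eq_iff)
next
  case (Rel r ts)
  then have ts: "list_all (tm_of L) ts" by simp
  then have "map (eval F e) ts = map rep ts"
    by (auto simp: list_all_iff eval_term_model)
  moreover have "list_all2 (\<lambda>s t. L; M \<turnstile> Eq s t) (map rep ts) ts"
    using ts by (induction ts) (auto simp: rep derives_Eq_sym)
  ultimately show ?case
    using list_all2_rep[OF ts] derives_Rel_cong unfolding sat.simps by metis
next
  case (Imp \<phi> \<psi>)
  then show ?case by (simp add: derives_Imp_iff)
qed simp

text \<open>Every element is the value of a term, so \<open>AllE\<close> covers each instance;
  \<open>\<theta>\<close> is arbitrary because instantiation alters the matrix.\<close>

lemma sat_universal:
  "open_fm \<theta> \<Longrightarrow> fm_of L \<theta> \<Longrightarrow> L; M \<turnstile> (All ^^ n) \<theta> \<Longrightarrow> sat D F R e ((All ^^ n) \<theta>)"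
proof (induction n arbitrary: \<theta>)
  case 0
  then show ?case by (simp add: sat_open_iff)
next
  case (Suc n)
  have "sat D F R (case_nat (rep t) e) ((All ^^ n) \<theta>)" if t: "tm_of L t" for t
  proof -
    let ?\<phi> = "subst (t \<rhd> Var) ((All ^^ n) \<theta>)"
    obtain \<tau> where \<tau>: "?\<phi> = (All ^^ n) (subst \<tau> \<theta>)"
      using subst_Alls by blast
    have "L; M \<turnstile> ?\<phi>" using Suc.prems(3) t by (auto intro: derives.AllE)
    moreover have "fm_of L ?\<phi>" using Suc.prems(2) t by (simp add: fm_of_inst)
    ultimately have "sat D F R e ?\<phi>"
      using Suc.IH[of "subst \<tau> \<theta>"] Suc.prems(1) \<tau> by (simp add: open_subst)
    then show ?thesis using t by (simp add: sat_inst eval_term_model)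
  qed
  then show ?case by auto
qed

end

section \<open>Herbrand's theorem and witnessing\<close>

text \<open>Free variables of \<open>\<chi>\<close> act as constants, and the terms in
  \<open>A\<close> may mention further variables.\<close>

theorem herbrand:
  assumes T: "universal_theory L T" and \<chi>: "fm_of L \<chi>" "open_fm \<chi>"
    and ex: "L; T \<turnstile> Ex \<chi>"
  obtains A where "finite A" "\<And>t. t \<in> A \<Longrightarrow> tm_of L t"
    "L; T \<union> (\<lambda>t. Neg (subst (t \<rhd> Var) \<chi>)) ` A \<turnstile> Fls"
proof -
  let ?N = "\<lambda>t. Neg (subst (t \<rhd> Var) \<chi>)"
  have "L; T \<union> ?N ` {t. tm_of L t} \<turnstile> Fls"
  proof (rule ccontr)
    assume "\<not> ?thesis"
    then obtain M where M: "T \<union> ?N ` {t. tm_of L t} \<subseteq> M" "complete_set L M"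
      by (rule complete_set_extension)
    interpret complete_set L M by fact
    have "sat D F R e \<phi>" if "\<phi> \<in> T" for \<phi>
    proof -
      from that T obtain n \<theta> where "open_fm \<theta>" "\<phi> = (All ^^ n) \<theta>" "fm_of L \<phi>"
        unfolding universal_theory_def theory_of_def sentence_of_def by blast
      moreover from this have "L; M \<turnstile> \<phi>" using that M by (auto intro: derives.Assm)
      ultimately show ?thesis using sat_universal by auto
    qed
    moreover have "range e \<subseteq> D" by (intro image_subsetI imageI) simp
    ultimately have "sat D F R e (Ex \<chi>)"
      by (intro soundness[OF ex structure_for_term_model])
    \<comment> \<open>The witness is the class of a term \<open>t\<close>, and \<open>M\<close>
      contains the negated instance at \<open>t\<close>.\<close>
    then obtain t where t: "tm_of L t" "sat D F R (case_nat (rep t) e) \<chi>" by auto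
    then have "L; M \<turnstile> subst (t \<rhd> Var) \<chi>"
      using \<chi> by (subst sat_open_iff[symmetric])
        (auto simp: sat_inst eval_term_model open_subst fm_of_inst)
    moreover have "L; M \<turnstile> ?N t"
      using t \<chi> M by (auto intro!: derives.Assm fm_of_inst)
    ultimately show False using consistent derives.ImpE by blast
  qed
  from derives_finite[OF this] obtain \<Delta>
    where \<Delta>: "finite \<Delta>" "\<Delta> \<subseteq> T \<union> ?N ` {t. tm_of L t}" "L; \<Delta> \<turnstile> Fls"
    by (elim exE conjE)
  then have "finite (\<Delta> - T)" "\<Delta> - T \<subseteq> ?N ` {t. tm_of L t}" by auto
  from finite_subset_image[OF this] obtain A
    where A: "A \<subseteq> {t. tm_of L t}" "finite A" "\<Delta> - T = ?N ` A"
    by (elim exE conjE)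
  have "L; T \<union> ?N ` A \<turnstile> Fls"
    using \<Delta>(3) by (rule derives_weaken) (use A(3) in blast)
  then show ?thesis using A by (intro that[of A]) auto
qed

text \<open>Terms are merged one at a time: the new term where it is a witness, the earlier merged
  term elsewhere. In \<open>\<chi>\<close>, index 0 is \<open>y\<close> and 1 is \<open>x\<close>;
  filling \<open>y\<close> turns \<open>x\<close> into index 0.\<close>

lemma merge_witnesses:
  assumes T: "theory_of L T" "closed_under_cases L T"
    and \<chi>: "fm_of L \<chi>" "open_fm \<chi>" "free_vars \<chi> \<subseteq> {0, 1}"
    and "finite A" "\<forall>t \<in> A. tm_of L t \<and> vars t \<subseteq> {0}"
  shows "\<exists>t. tm_of L t \<and> vars t \<subseteq> {0} \<and>
           (\<forall>s \<in> A. L; T \<turnstile> Imp (subst (s \<rhd> Var) \<chi>) (subst (t \<rhd> Var) \<chi>))"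
  using assms(6,7)
proof (induction rule: finite_induct)
  case empty
  \<comment> \<open>With no candidates any term in \<open>x\<close> will do; \<open>Var 0\<close>
    exists even without constants.\<close>
  show ?case by (intro exI[of _ "Var 0"]) simp
next
  case (insert t1 A)
  let ?\<chi> = "\<lambda>t. subst (t \<rhd> Var) \<chi>"
  obtain t2 where t2: "tm_of L t2" "vars t2 \<subseteq> {0}" "\<And>s. s \<in> A \<Longrightarrow> L; T \<turnstile> Imp (?\<chi> s) (?\<chi> t2)"
    using insert by blast
  have t1: "tm_of L t1" "vars t1 \<subseteq> {0}" using insert by auto
  have "fm_of L (?\<chi> t1)" "open_fm (?\<chi> t1)" "free_vars (?\<chi> t1) \<subseteq> {..<1}"
    using \<chi> t1 by (auto simp: fm_of_inst open_subst free_vars_open_subst split: nat.splits)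
  then obtain t where t: "tm_of L t" "vars t \<subseteq> {0}" and
    "L; T \<turnstile> (All ^^ 1) (Or (And (?\<chi> t1) (Eq t t1)) (And (Neg (?\<chi> t1)) (Eq t t2)))"
    using T(2)[unfolded closed_under_cases_def, rule_format, of "?\<chi> t1" 1 t1 t2] t1 t2
    by (auto simp: lessThan_Suc)
  then have cases: "L; T \<turnstile> Or (And (?\<chi> t1) (Eq t t1)) (And (Neg (?\<chi> t1)) (Eq t t2))"
    using T by (simp add: theory_derives_All)
  have fm: "fm_of L (?\<chi> s)" if "tm_of L s" for s using that \<chi> by (simp add: fm_of_inst)
  have *: "L; T \<turnstile> Imp (?\<chi> s) (?\<chi> t)" if s: "s \<in> insert t1 A" for s
  proof (rule derives_if_complete)
    have fm_s: "tm_of L s" using s insert.prems by blast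
    then show "fm_of L (Imp (?\<chi> s) (?\<chi> t))" using t fm by simp
    fix M assume M: "T \<subseteq> M" "complete_set L M"
    interpret complete_set L M by fact
    have Eq: "L; M \<turnstile> ?\<chi> t" if "L; M \<turnstile> Eq t u" "L; M \<turnstile> ?\<chi> u" for u
      using that t derives_Eq_sym derives.EqSubst by metis
    have neg: "fm_of L \<phi> \<Longrightarrow> L; M \<turnstile> Neg \<phi> \<longleftrightarrow> \<not> L; M \<turnstile> \<phi>" for \<phi>
      by (simp add: derives_Imp_iff consistent)
    have "L; M \<turnstile> Or (And (?\<chi> t1) (Eq t t1)) (And (Neg (?\<chi> t1)) (Eq t t2))"
      using cases M derives_weaken by blast
    then have "L; M \<turnstile> ?\<chi> t1 \<and> L; M \<turnstile> Eq t t1 \<or> \<not> L; M \<turnstile> ?\<chi> t1 \<and> L; M \<turnstile> Eq t t2"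
      using t t1 t2 fm consistent by (auto simp: derives_Imp_iff)
    \<comment> \<open>If \<open>t1\<close> is a witness, so is \<open>t\<close>. Otherwise
      \<open>s = t1\<close> is vacuous, and for \<open>s\<close> in \<open>A\<close> the property
      passes through \<open>t2\<close> to \<open>t\<close>.\<close>
    moreover have "L; M \<turnstile> Imp (?\<chi> s) (?\<chi> t2)" if "s \<in> A"
      using t2(3)[OF that] M derives_weaken by blast
    ultimately have "L; M \<turnstile> ?\<chi> s \<longrightarrow> L; M \<turnstile> ?\<chi> t"
      using Eq s derives.ImpE by blast
    then show "L; M \<turnstile> Imp (?\<chi> s) (?\<chi> t)"
      using fm t fm_s by (simp add: derives_Imp_iff)
  qed
  then show ?case using t by blast
qed

theorem universal_witness:
  assumes T: "universal_theory L T" "closed_under_cases L T"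
    and \<chi>: "fm_of L \<chi>" "open_fm \<chi>" "free_vars \<chi> \<subseteq> {0, 1}"
    and ex: "L; T \<turnstile> All (Ex \<chi>)"
  shows "\<exists>t. tm_of L t \<and> vars t \<subseteq> {0} \<and> L; T \<turnstile> All (subst (t \<rhd> Var) \<chi>)"
proof -
  let ?\<chi> = "\<lambda>t. subst (t \<rhd> Var) \<chi>"
  \<comment> \<open>Herbrand terms may contain variables other than \<open>x\<close>; this
    substitution collapses them all to \<open>x\<close>.\<close>
  let ?\<sigma> = "\<lambda>_ :: nat. Var 0 :: 'a tm"
  have th: "theory_of L T" using T by (simp add: universal_theory_def)
  then have "L; T \<turnstile> Ex \<chi>" using ex by (simp add: theory_derives_All)
  then obtain A where A: "finite A" "\<And>t. t \<in> A \<Longrightarrow> tm_of L t"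
    and "L; T \<union> (\<lambda>t. Neg (?\<chi> t)) ` A \<turnstile> Fls"
    using herbrand[OF T(1) \<chi>(1,2)] by metis
  then have "L; subst ?\<sigma> ` (T \<union> (\<lambda>t. Neg (?\<chi> t)) ` A) \<turnstile> subst ?\<sigma> Fls"
    by (intro derives_subst) simp_all
  \<comment> \<open>Only \<open>x\<close> and \<open>y\<close> occur in \<open>\<chi>\<close>, so
    the collapse acts on the witness term alone.\<close>
  moreover have "subst ?\<sigma> (?\<chi> t) = ?\<chi> (subst_tm ?\<sigma> t)" for t
    unfolding subst_subst using \<chi>(3) by (intro subst_cong) (auto split: nat.split)
  ultimately have Fls: "L; T \<union> (\<lambda>t. Neg (?\<chi> t)) ` subst_tm ?\<sigma> ` A \<turnstile> Fls"
    using th by (simp add: image_Un image_image theory_subst)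
  have B: "\<forall>t \<in> subst_tm ?\<sigma> ` A. tm_of L t \<and> vars t \<subseteq> {0}"
    using A by (auto simp: tm_of_subst_tm vars_subst_tm split: if_splits)
  from merge_witnesses[OF th T(2) \<chi> finite_imageI[OF A(1)] B]
  obtain t where t: "tm_of L t" "vars t \<subseteq> {0}"
    and imp: "\<forall>s \<in> subst_tm ?\<sigma> ` A. L; T \<turnstile> Imp (?\<chi> s) (?\<chi> t)"
    by (elim exE conjE)
  have "L; T \<turnstile> ?\<chi> t"
  proof (rule derives_if_complete)
    fix M assume M: "T \<subseteq> M" "complete_set L M"
    interpret complete_set L M by fact
    show "L; M \<turnstile> ?\<chi> t"
    proof (rule ccontr)
      assume not: "\<not> ?thesis"
      \<comment> \<open>If \<open>t\<close> fails in \<open>M\<close>, so does every Herbrand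
        candidate, and \<open>M\<close> contains the inconsistent set.\<close>
      have "Neg (?\<chi> s) \<in> M" if s: "s \<in> subst_tm ?\<sigma> ` A" for s
      proof -
        have "L; M \<turnstile> Imp (?\<chi> s) (?\<chi> t)"
          using bspec[OF imp s] M(1) by (rule derives_weaken)
        with not have "\<not> L; M \<turnstile> ?\<chi> s" using derives.ImpE by metis
        moreover have "fm_of L (?\<chi> s)" using bspec[OF B s] \<chi> by (simp add: fm_of_inst)
        ultimately show ?thesis using complete derives_iff_mem by metis
      qed
      then have "T \<union> (\<lambda>t. Neg (?\<chi> t)) ` subst_tm ?\<sigma> ` A \<subseteq> M" using M by blast
      then show False using derives_weaken[OF Fls] consistent by simp
    qed
  qed (use t \<chi> in \<open>simp add: fm_of_inst\<close>)
  then show ?thesis using t th by (auto simp: theory_derives_All)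
qed

text \<open>\<open>t\<close> is placed in the scope of the existential quantifier and may use its
  variable as index 0; this lets \<open>z\<close> become \<alpha>(x,y).\<close>

lemma derives_Ex_All_inst:
  assumes "L; \<Gamma> \<turnstile> Ex (All \<psi>)" "fm_of L \<psi>" "tm_of L t"
  shows "L; \<Gamma> \<turnstile> Ex (subst (t \<rhd> Var) \<psi>)"
proof (rule derives.ImpI)
  let ?\<chi> = "subst (t \<rhd> Var) \<psi>"
  let ?\<Delta> = "insert (All (Neg ?\<chi>)) \<Gamma>"
  have fm: "fm_of L ?\<chi>" using assms by (simp add: fm_of_inst)
  then show "fm_of L (All (Neg ?\<chi>))" by simp
  then have "L; ?\<Delta> \<turnstile> All (Neg ?\<chi>)" by (auto intro: derives.Assm)
  \<comment> \<open>The existential variable becomes the eigenvariable 0; there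
    \<open>All \<psi>\<close> would yield the instance just negated.\<close>
  then have "L; lift ` ?\<Delta> \<turnstile> Neg ?\<chi>" by (simp only: derives_All_iff)
  then have "L; insert (All \<psi>) (lift ` ?\<Delta>) \<turnstile> Neg ?\<chi>" by (auto elim: derives_weaken)
  moreover have "L; insert (All \<psi>) (lift ` ?\<Delta>) \<turnstile> ?\<chi>"
    using assms by (intro derives.AllE[of L _ \<psi>] derives.Assm) simp_all
  ultimately have "L; lift ` ?\<Delta> \<turnstile> Neg (All \<psi>)"
    using assms by - (rule derives.ImpI[OF derives.ImpE[of L _ ?\<chi>]], simp_all)
  then have "L; ?\<Delta> \<turnstile> All (Neg (All \<psi>))" by (rule derives.AllI)
  moreover have "L; ?\<Delta> \<turnstile> Ex (All \<psi>)" using assms(1) by (rule derives_weaken) blast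
  ultimately show "L; ?\<Delta> \<turnstile> Fls" by - (rule derives.ImpE)
qed

theorem theorem4p6:
  fixes \<alpha> :: 'f
    and L Lw L' :: "('f, 'r) lang"
    and S T T' :: "('f, 'r) fm set"
    and \<psi> :: "('f, 'r) fm"
  assumes "(\<alpha>, 2) \<in> funs Lw"
    and "sublang L (remove_fun Lw (\<alpha>, 2))"
    and "universal_theory Lw T"
    and "closed_under_cases Lw T"
    and "AE_conservative_extension L' T' Lw T"
    and "theory_of L S" and "S \<subseteq> T'"
    and "fm_of L \<psi>" and "open_fm \<psi>" and "free_vars \<psi> \<subseteq> {0, 1, 2}"
    \<comment> \<open>in \<open>\<psi>\<close>, the variables \<open>x\<close>, \<open>y\<close>, \<open>z\<close> are the de Bruijn indices 2, 1, 0\<close>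
    and "L; S \<turnstile> All (Ex (All \<psi>))"
  shows "\<exists>t. tm_of Lw t \<and> vars t \<subseteq> {0} \<and>
           Lw; T \<turnstile> All (subst (Fun \<alpha> [Var 0, t] \<rhd> t \<rhd> Var) \<psi>)"
proof -
  \<comment> \<open>Once \<open>z\<close> is filled, \<open>x\<close> is index 1 and
    \<open>y\<close> index 0, so \<open>\<chi>\<close> is \<psi>(x,y,\<alpha>(x,y)).\<close>
  define \<chi> where "\<chi> = subst (Fun \<alpha> [Var 1, Var 0] \<rhd> Var) \<psi>"
  have LLw: "sublang L Lw" using assms(2) by (auto simp: sublang_def remove_fun_def)
  have LwL': "sublang Lw L'" and T': "theory_of L' T'"
    and cons: "conservative_over (AE_sentences Lw) L' T' Lw T"
    using assms(5) by (auto simp: AE_conservative_extension_def)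
  have LL': "sublang L L'" using LLw LwL' by (auto simp: sublang_def)
  \<comment> \<open>\<open>\<alpha>\<close> lies outside \<open>L\<close>, so the instantiation
    takes place in \<open>L'\<close>, after the derivation has been transferred there.\<close>
  have \<alpha>: "tm_of Lw (Fun \<alpha> [Var 1, Var 0])"
    using assms(1) by (simp add: numeral_2_eq_2)
  have \<chi>: "fm_of Lw \<chi>" "open_fm \<chi>"
    using fm_of_inst[OF fm_of_mono[OF assms(8) LLw] \<alpha>] assms(9)
    by (simp_all add: \<chi>_def open_subst)
  have fv: "free_vars \<chi> \<subseteq> {0, 1}"
    using assms(9,10) by (auto simp: \<chi>_def free_vars_open_subst split: nat.splits)
  \<comment> \<open>Filling \<open>y\<close> by \<open>t\<close> also turns the inner \<alpha>(x,y)
    into \<alpha>(x,t(x)) and moves \<open>x\<close> to index 0.\<close>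
  have inst: "subst (t \<rhd> Var) \<chi> = subst (Fun \<alpha> [Var 0, t] \<rhd> t \<rhd> Var) \<psi>" for t
    unfolding \<chi>_def subst_subst by (rule subst_cong) (simp split: nat.split)
  have "L'; T' \<turnstile> All (Ex (All \<psi>))"
    using derives_mono[OF assms(11,7) LL'] .
  then have "L'; T' \<turnstile> Ex (All \<psi>)" using T' by (simp only: theory_derives_All)
  then have "L'; T' \<turnstile> Ex \<chi>" unfolding \<chi>_def
    by (rule derives_Ex_All_inst[OF _ fm_of_mono[OF assms(8) LL'] tm_of_mono[OF \<alpha> LwL']])
  then have "L'; T' \<turnstile> All (Ex \<chi>)" using T' by (simp only: theory_derives_All)
  moreover have "All (Ex \<chi>) \<in> AE_sentences Lw"
  proof -
    have "All (Ex \<chi>) = (All ^^ 1) ((Ex ^^ 1) \<chi>)" by simp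
    moreover have "sentence_of Lw (All (Ex \<chi>))" using \<chi> fv by (auto simp: sentence_of_def)
    ultimately show ?thesis using \<chi> unfolding AE_sentences_def by blast
  qed
  moreover have "fm_of L' \<chi>" using \<chi>(1) LwL' by (rule fm_of_mono)
  ultimately have "Lw; T \<turnstile> All (Ex \<chi>)"
    using cons \<chi>(1) unfolding conservative_over_def by auto
  from universal_witness[OF assms(3,4) \<chi> fv this] show ?thesis by (simp only: inst)
qed

end
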